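(* Let $\mu$ be an ergodic $\sigma$-invariant Borel probability measure on $\Omega=\{-1,0,+1\}^{\mathbb Z}$ which is strongly asymmetric. Then the scenery measure is determined by the global record measure: if $\lambda$ and $\lambda'$ are two scenery measures on $X=\{0,1\}^{\mathbb Z}$ whose global record measures $\rho=(\mu\times\lambda)\circ\Phi^{-1}$ and $\rho'=(\mu\times\lambda')\circ\Phi^{-1}$ satisfy $\rho=\rho'$, then $\lambda=\lambda'$.
   Context: Let $J=\{-1,0,+1\}$ be the set of steps, whose elements are also written $\mathtt L=-1$, $\mathtt H=0$, $\mathtt R=+1$ (left, hold, right). Let $\Omega=J^{\mathbb Z}$ with its Borel $\sigma$-algebra and left shift $\sigma$, $(\sigma\omega)_n=\omega_{n+1}$. A generalized random walk with holding is given by an ergodic shift-invariant probability measure $\mu$ on $\Omega$ (holding steps are allowed but $\mu(\omega_0=0)=0$ is not excluded). For a word $u=u_1\dots u_n$ over $J$ put $\mu[u]=\mu(\{\omega\in\Omega:\omega_0\dots\omega_{n-1}=u\})$. Write $\mathtt R^N$ and $\mathtt L^N$ for the words consisting of $N$ letters $\mathtt R$, respectively $N$ letters $\mathtt L$. The walk (or $\mu$) is called strongly asymmetric if $\mu[\mathtt R^N]\neq\mu[\mathtt L^N]$ for every integer $N\ge 1$. Let $X=\{0,1\}^{\mathbb Z}$ with its Borel $\sigma$-algebra and left shift $T$, $(Tx)_k=x_{k+1}$. A scenery measure is an ergodic $T$-invariant Borel probability measure on $X$. For $\omega\in\Omega$ and $x\in X$ define $r_0(\omega,x)=x_0$; for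 $n\ge1$, $r_n(\omega,x)=(T^{\omega_0+\cdots+\omega_{n-1}}x)_0$; for $n<0$, $r_n(\omega,x)=(T^{-\omega_{-1}-\omega_{-2}-\cdots-\omega_{n}}x)_0$. The global recording map is $\Phi:\Omega\times X\to X$, $\Phi(\omega,x)=(r_n(\omega,x))_{n\in\mathbb Z}$. The global record measure of a scenery measure $\lambda$ is $\rho=(\mu\times\lambda)\circ\Phi^{-1}$. *)

theory Defs
  imports "HOL-Probability.Probability"
begin

definition shift :: "(int \<Rightarrow> 'a) \<Rightarrow> int \<Rightarrow> 'a" where
  "shift x = (\<lambda>k. x (k + 1))"

text \<open>The integer power of the shift; negative exponents shift to the right,
  see \<open>shift_pow_nonneg\<close> and \<open>shift_pow_minus\<close> below.\<close>

definition shift_pow :: "int \<Rightarrow> (int \<Rightarrow> 'a) \<Rightarrow> int \<Rightarrow> 'a" where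
  "shift_pow s x = (\<lambda>k. x (k + s))"

lemma shift_pow_nonneg: "shift_pow (int n) = shift ^^ n"
  by (induction n) (auto simp: fun_eq_iff shift_def shift_pow_def algebra_simps)

lemma shift_pow_minus:
  "shift_pow (- s) \<circ> shift_pow s = id" "shift_pow s \<circ> shift_pow (- s) = id"
  by (auto simp: fun_eq_iff shift_pow_def)

definition full_shift :: "'a set \<Rightarrow> (int \<Rightarrow> 'a) measure" where
  "full_shift A = (\<Pi>\<^sub>M n\<in>UNIV. count_space A)"

lemma space_full_shift: "space (full_shift A) = {x. \<forall>n. x n \<in> A}"
  by (auto simp: full_shift_def space_PiM)

text \<open>The product \<open>\<sigma>\<close>-algebra is the Borel \<open>\<sigma>\<close>-algebra of the product topology.\<close>

lemma sets_full_shift_eq_borel: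
  fixes A :: "'a :: {countable, t2_space, second_countable_topology} set"
  shows "sets (full_shift A) = sets (restrict_space borel {x. \<forall>n. x n \<in> A})"
proof (rule antisym)
  let ?S = "{x :: int \<Rightarrow> 'a. \<forall>n. x n \<in> A}"
  let ?B = "restrict_space borel ?S"
  have count: "sets (borel :: 'a measure) = sets (count_space UNIV)"
    by (simp add: sets_borel_eq_count_space)
  have space_B: "space ?B = ?S"
    by (simp add: space_restrict_space)
  have comp: "(\<lambda>x. x n) \<in> measurable ?B (count_space A)" for n
  proof (rule measurableI)
    show "x n \<in> space (count_space A)" if "x \<in> space ?B" for x
      using that by (simp add: space_B)
    fix C assume "C \<in> sets (count_space A)"
    have "(\<lambda>x :: int \<Rightarrow> 'a. x n) \<in> borel_measurable (PiM UNIV (\<lambda>_. borel))"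
      by measurable
    then have "(\<lambda>x :: int \<Rightarrow> 'a. x n) \<in> borel_measurable borel"
      using measurable_cong_sets[OF sets_PiM_equal_borel refl] by blast
    then have "(\<lambda>x. x n) \<in> borel_measurable ?B"
      by (rule measurable_restrict_space1)
    moreover have "C \<in> sets borel"
      unfolding count by simp
    ultimately show "(\<lambda>x. x n) -` C \<inter> space ?B \<in> sets ?B"
      by (rule measurable_sets)
  qed
  have "(\<lambda>x. x) \<in> measurable ?B (full_shift A)"
    unfolding full_shift_def
    by (rule measurable_PiM_single') (use comp in \<open>auto simp: space_B\<close>)
  then have "E \<in> sets ?B" if "E \<in> sets (full_shift A)" for E
    using measurable_sets[of "\<lambda>x. x" ?B "full_shift A" E] that sets.sets_into_space[OF that]
    by (simp add: space_B space_full_shift Int_absorb2)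
  then show "sets (full_shift A) \<subseteq> sets ?B"
    by blast
  have "(\<lambda>x. x n) \<in> borel_measurable (full_shift A)" for n
    unfolding full_shift_def
    by (rule measurable_compose[OF measurable_component_singleton]) auto
  then have "(\<lambda>x. x) \<in> measurable (full_shift A) (PiM UNIV (\<lambda>_. borel))"
    by (intro measurable_PiM_single') auto
  then have "(\<lambda>x. x) \<in> measurable (full_shift A) borel"
    using measurable_cong_sets[OF refl sets_PiM_equal_borel] by blast
  then have "(\<lambda>x. x) \<in> measurable (full_shift A) ?B"
    by (intro measurable_restrict_space2) (auto simp: space_full_shift)
  then have "E \<in> sets (full_shift A)" if "E \<in> sets ?B" for E
    using measurable_sets[of "\<lambda>x. x" "full_shift A" ?B E] that sets.sets_into_space[OF that]
    by (simp add: space_B space_full_shift Int_absorb2)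
  then show "sets ?B \<subseteq> sets (full_shift A)"
    by blast
qed

definition ergodic_measure :: "'a measure \<Rightarrow> ('a \<Rightarrow> 'a) \<Rightarrow> bool" where
  "ergodic_measure M T \<longleftrightarrow>
     prob_space M \<and> T \<in> measurable M M \<and> distr M M T = M \<and>
     (\<forall>A\<in>sets M. T -` A \<inter> space M = A \<longrightarrow> measure M A = 0 \<or> measure M A = 1)"

definition step_space :: "(int \<Rightarrow> int) measure" where
  "step_space = full_shift {- 1, 0, 1}"

definition scenery_space :: "(int \<Rightarrow> nat) measure" where
  "scenery_space = full_shift {0, 1}"

instance int :: second_countable_topology
proof
  show "\<exists>B :: int set set. countable B \<and> open = generate_topology B"
    by (intro exI[of _ "range lessThan \<union> range greaterThan"] conjI)
       (auto simp: open_int_def)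
qed

lemma sets_step_space:
  "sets step_space = sets (restrict_space borel {\<omega>. \<forall>n. \<omega> n \<in> {- 1, 0, 1}})"
  unfolding step_space_def by (rule sets_full_shift_eq_borel)

lemma sets_scenery_space:
  "sets scenery_space = sets (restrict_space borel {x. \<forall>k. x k \<in> {0, 1}})"
  unfolding scenery_space_def by (rule sets_full_shift_eq_borel)

definition random_walk :: "(int \<Rightarrow> int) measure \<Rightarrow> bool" where
  "random_walk \<mu> \<longleftrightarrow> sets \<mu> = sets step_space \<and> ergodic_measure \<mu> shift"

definition scenery_measure :: "(int \<Rightarrow> nat) measure \<Rightarrow> bool" where
  "scenery_measure \<nu> \<longleftrightarrow> sets \<nu> = sets scenery_space \<and> ergodic_measure \<nu> shift"

definition word_prob :: "(int \<Rightarrow> int) measure \<Rightarrow> int list \<Rightarrow> real" where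
  "word_prob \<mu> u = measure \<mu> {\<omega> \<in> space step_space. \<forall>i<length u. \<omega> (int i) = u ! i}"

definition strongly_asymmetric :: "(int \<Rightarrow> int) measure \<Rightarrow> bool" where
  "strongly_asymmetric \<mu> \<longleftrightarrow>
     (\<forall>N\<ge>1. word_prob \<mu> (replicate N 1) \<noteq> word_prob \<mu> (replicate N (- 1)))"

definition recorded :: "int \<Rightarrow> (int \<Rightarrow> int) \<Rightarrow> (int \<Rightarrow> nat) \<Rightarrow> nat" where
  "recorded n \<omega> x =
     (if n \<ge> 0 then shift_pow (\<Sum>i\<in>{0..<n}. \<omega> i) x 0
      else shift_pow (- (\<Sum>i\<in>{n..-1}. \<omega> i)) x 0)"

definition recording_map :: "(int \<Rightarrow> int) \<times> (int \<Rightarrow> nat) \<Rightarrow> int \<Rightarrow> nat" where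
  "recording_map = (\<lambda>(\<omega>, x). (\<lambda>n. recorded n \<omega> x))"

definition record_measure ::
    "(int \<Rightarrow> int) measure \<Rightarrow> (int \<Rightarrow> nat) measure \<Rightarrow> (int \<Rightarrow> nat) measure" where
  "record_measure \<mu> \<nu> = distr (\<mu> \<Otimes>\<^sub>M \<nu>) scenery_space recording_map"

lemma measurable_component_full_shift:
  "(\<lambda>x. x n) \<in> measurable (full_shift A) (count_space A)"
  unfolding full_shift_def by measurable

lemma measurable_recording_map:
  "recording_map \<in> measurable (step_space \<Otimes>\<^sub>M scenery_space) scenery_space"
proof -
  let ?M = "step_space \<Otimes>\<^sub>M scenery_space"
  define p where "p n \<omega> = (if n \<ge> 0 then (\<Sum>i\<in>{0..<n}. \<omega> i) else - (\<Sum>i\<in>{n..-1}. \<omega> i))"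
    for n :: int and \<omega> :: "int \<Rightarrow> int"
  have step: "(\<lambda>\<omega>. \<omega> i) \<in> measurable step_space (count_space UNIV)" for i
    using measurable_component_full_shift[of i "{-1,0,1::int}"]
    unfolding step_space_def by (rule measurable_compose) auto
  have sum: "(\<lambda>\<omega>. \<Sum>i\<in>I. \<omega> i) \<in> measurable step_space (count_space UNIV)" if "finite I" for I
    using that
  proof induction
    case (insert j I)
    have "(\<lambda>\<omega>. (\<lambda>a \<omega>. a + (\<Sum>i\<in>I. \<omega> i)) (\<omega> j) \<omega>) \<in> measurable step_space (count_space UNIV)"
      by (rule measurable_compose_countable[OF measurable_compose[OF insert.IH] step]) simp
    then show ?case using insert.hyps by simp
  qed simp
  have "p n \<in> measurable step_space (count_space UNIV)" for n
  proof -
    note [measurable] = sum[of "{0..<n}", simplified] sum[of "{n..-1}", simplified]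
    show ?thesis unfolding p_def by measurable
  qed
  then have pos: "(\<lambda>z. p n (fst z)) \<in> measurable ?M (count_space UNIV)" for n
    by (rule measurable_compose[OF measurable_fst])
  have "(\<lambda>z. (\<lambda>i z. snd z i) (p n (fst z)) z) \<in> measurable ?M (count_space {0,1::nat})" for n
  proof (rule measurable_compose_countable[OF _ pos])
    show "(\<lambda>z. snd z i) \<in> measurable ?M (count_space {0,1::nat})" for i
      using measurable_compose[OF measurable_snd measurable_component_full_shift]
      unfolding scenery_space_def by blast
  qed
  then have comp: "(\<lambda>z. snd z (p n (fst z))) \<in> measurable ?M (count_space {0,1})" for n
    by simp
  have "(\<lambda>z n. snd z (p n (fst z))) \<in> measurable ?M (PiM UNIV (\<lambda>_. count_space {0,1}))"
    by (rule measurable_PiM_single')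
       (use comp measurable_space[OF comp] in \<open>simp_all add: PiE_UNIV_domain Pi_iff\<close>)
  then have "(\<lambda>z n. snd z (p n (fst z))) \<in> measurable ?M scenery_space"
    by (simp only: scenery_space_def full_shift_def)
  also have "(\<lambda>z n. snd z (p n (fst z))) = recording_map"
    by (auto simp: recording_map_def recorded_def shift_pow_def p_def fun_eq_iff)
  finally show ?thesis .
qed

end

theory Submission
  imports Defs
begin

text \<open>
  Only words of the scenery matter: a measure on the full shift is determined by the laws of its
  finite windows (\<open>measure_eqI_window_law\<close>), and these are recovered by induction on the window
  length.

  The first \<open>N + 1\<close> letters of the record are the scenery read along the path given by the first
  \<open>N\<close> steps of the walk. As walk and scenery are independent, the probability that the record
  starts with \<open>w\<close> is \<open>\<Sum>\<^sub>u \<mu>[u] \<nu>(w is read along u)\<close>, the sum being over the step words \<open>u\<close> of length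
  \<open>N\<close> (\<open>record_window_law\<close>). The path of \<open>u\<close> sees \<open>N + 1\<close> distinct sites only if it goes straight
  to the right or straight to the left. Any other path stays inside a window of \<open>N\<close> sites
  (\<open>sites_confined\<close>), so by stationarity its term is already known from the law of windows of
  length \<open>N\<close>. The two straight paths read \<open>w\<close> forwards or backwards and contribute
  \<open>p \<nu>[w] + q \<nu>[rev w]\<close>, where \<open>p\<close> and \<open>q\<close> are the probabilities of \<open>N\<close> steps to the right and of
  \<open>N\<close> steps to the left.

  Two sceneries with the same record and the same law of windows of length \<open>N\<close> thus differ by
  some \<open>d\<close> with \<open>p d(w) + q d(rev w) = 0\<close> for every word \<open>w\<close> of length \<open>N + 1\<close>. Together with the
  same equation for \<open>rev w\<close> this is a linear system with determinant \<open>p\<^sup>2 - q\<^sup>2\<close>, which for \<open>N \<ge> 1\<close> is nonzero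
  because \<open>p\<close> and \<open>q\<close> are nonnegative and, by strong asymmetry, distinct; hence \<open>d = 0\<close>
  (\<open>window_law_Suc_of_record\<close>). The induction starts with \<open>N = 0\<close>, where the only path is empty and
  the record shows the letter of the scenery at the origin.
\<close>

section \<open>Words seen in a window\<close>

definition window :: "int \<Rightarrow> nat \<Rightarrow> (int \<Rightarrow> 'a) \<Rightarrow> 'a list" where
  "window a n x = map (\<lambda>i. x (a + int i)) [0..<n]"

lemma length_window [simp]: "length (window a n x) = n"
  by (simp add: window_def)

lemma window_nth: "i < n \<Longrightarrow> window a n x ! i = x (a + int i)"
  by (simp add: window_def)

lemma window_eq_iff:
  "window a n x = w \<longleftrightarrow> length w = n \<and> (\<forall>i<n. x (a + int i) = w ! i)"
  by (auto simp: list_eq_iff_nth_eq window_nth)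

lemma nth_window_diff:
  "a \<le> s \<Longrightarrow> s < a + int n \<Longrightarrow> window a n x ! nat (s - a) = x s"
  by (simp add: window_nth nat_less_iff)

lemma window_shift_pow: "window a n x = window 0 n (shift_pow a x)"
  by (simp add: window_def shift_pow_def add.commute)

lemma measurable_window:
  fixes A :: "'a :: countable set"
  assumes "sets M = sets (full_shift A)"
  shows "window a n \<in> measurable M (count_space UNIV)"
proof -
  have comp: "(\<lambda>x. x k) \<in> measurable M (count_space UNIV)" for k
    unfolding measurable_cong_sets[OF assms refl]
    by (rule measurable_compose[OF measurable_component_full_shift]) simp
  have "{x \<in> space M. window a n x = w} \<in> sets M" for w
    unfolding window_eq_iff using comp by measurable
  then show ?thesis
    by (auto simp: measurable_count_space_eq_countable vimage_def Int_def conj_commute)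
qed

lemma measurable_shift_pow:
  "shift_pow s \<in> measurable (full_shift A) (full_shift A)"
proof -
  have "(\<lambda>x k. x (k + s)) \<in> measurable (full_shift A) (PiM UNIV (\<lambda>_. count_space A))"
    by (rule measurable_PiM_single')
       (auto simp: measurable_component_full_shift space_full_shift)
  then show ?thesis
    by (simp add: full_shift_def shift_pow_def[abs_def])
qed

definition window_law :: "(int \<Rightarrow> 'a) measure \<Rightarrow> int \<Rightarrow> nat \<Rightarrow> 'a list measure" where
  "window_law M a n = distr M (count_space UNIV) (window a n)"

lemma measure_window_law:
  fixes A :: "'a :: countable set"
  assumes "sets M = sets (full_shift A)"
  shows "measure M {x \<in> space M. P (window a n x)} = measure (window_law M a n) {v. P v}"
  unfolding window_law_def
  by (subst measure_distr) (auto simp: measurable_window[OF assms] vimage_def Int_def conj_commute)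

lemma window_law_eqI:
  fixes A :: "'a :: countable set"
  assumes M: "sets M = sets (full_shift A)" "prob_space M"
    and N: "sets N = sets (full_shift A)" "prob_space N"
    and eq: "\<And>w. length w = n \<Longrightarrow>
      measure (window_law M a n) {w} = measure (window_law N a n) {w}"
  shows "window_law M a n = window_law N a n"
proof (rule measure_eqI_countable[where A = UNIV])
  interpret M: prob_space "window_law M a n"
    unfolding window_law_def by (rule prob_space.prob_space_distr[OF M(2) measurable_window[OF M(1)]])
  interpret N: prob_space "window_law N a n"
    unfolding window_law_def by (rule prob_space.prob_space_distr[OF N(2) measurable_window[OF N(1)]])
  fix w :: "'a list"
  have "measure (window_law M a n) {w} = measure (window_law N a n) {w}"
  proof (cases "length w = n")
    case False
    then have "window a n x \<noteq> w" for x :: "int \<Rightarrow> 'a" by auto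
    then show ?thesis
      using measure_window_law[OF M(1), of "\<lambda>v. v = w" a n]
        measure_window_law[OF N(1), of "\<lambda>v. v = w" a n]
      by simp
  qed (rule eq)
  then show "emeasure (window_law M a n) {w} = emeasure (window_law N a n) {w}"
    by (simp add: M.emeasure_eq_measure N.emeasure_eq_measure)
qed (auto simp: window_law_def)

text \<open>Invariance under the shift gives invariance under its inverse because
  \<open>shift_pow (- s)\<close> undoes \<open>shift_pow s\<close>. The negative powers are needed to move words read by a
  walk to the left, and paths confined to an arbitrary window, back to the origin.\<close>

lemma distr_shift_pow:
  assumes sets: "sets M = sets (full_shift A)" and inv: "distr M M shift = M"
  shows "distr M M (shift_pow s) = M"
proof -
  have meas: "shift_pow s \<in> measurable M M" for s
    unfolding measurable_cong_sets[OF sets sets] by (rule measurable_shift_pow)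
  have comp: "distr (distr M M (shift_pow t)) M (shift_pow s) = distr M M (shift_pow s \<circ> shift_pow t)"
    for s t by (rule distr_distr[OF meas meas])
  have shift: "shift = (shift_pow 1 :: (int \<Rightarrow> 'a) \<Rightarrow> _)"
    by (auto simp: shift_def shift_pow_def)
  have nonneg: "distr M M (shift_pow (int n)) = M" for n
  proof (induction n)
    case 0
    have "shift_pow 0 = (\<lambda>x :: int \<Rightarrow> 'a. x)" by (auto simp: shift_pow_def)
    then show ?case by simp
  next
    case (Suc n)
    have "shift_pow (int (Suc n)) = shift_pow 1 \<circ> (shift_pow (int n) :: (int \<Rightarrow> 'a) \<Rightarrow> _)"
      by (auto simp: shift_pow_def fun_eq_iff algebra_simps)
    then show ?case
      using comp[where s = 1 and t = "int n"] Suc.IH inv[unfolded shift] by (simp only:)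
  qed
  show ?thesis
  proof (cases "s \<ge> 0")
    case True
    then show ?thesis using nonneg[of "nat s"] by simp
  next
    case False
    then have "distr M M (shift_pow (- s)) = M"
      using nonneg[of "nat (- s)"] by simp
    then show ?thesis
      using comp[where s = s and t = "- s"] by (simp add: shift_pow_minus id_def)
  qed
qed

lemma window_law_stationary:
  fixes A :: "'a :: countable set"
  assumes sets: "sets M = sets (full_shift A)" and inv: "distr M M shift = M"
  shows "window_law M a n = window_law M 0 n"
proof -
  have "shift_pow a \<in> measurable M M"
    unfolding measurable_cong_sets[OF sets sets] by (rule measurable_shift_pow)
  then have "window_law (distr M M (shift_pow a)) 0 n = window_law M a n"
    unfolding window_law_def
    by (subst distr_distr)
       (auto simp: measurable_window[OF sets] o_def simp flip: window_shift_pow)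
  then show ?thesis
    by (simp add: distr_shift_pow[OF assms])
qed

text \<open>A cylinder over a finite set \<open>J\<close> of coordinates is an event about any one window that
  covers \<open>J\<close>, and the cylinders generate the \<open>\<sigma>\<close>-algebra and are stable under intersection.\<close>

lemma measure_eqI_window_law:
  fixes A :: "'a :: countable set"
  assumes M: "sets M = sets (full_shift A)" "prob_space M"
    and N: "sets N = sets (full_shift A)" "prob_space N"
    and eq: "\<And>a n. window_law M a n = window_law N a n"
  shows "M = N"
proof (rule measure_eqI_PiM_infinite[where I = UNIV and M = "\<lambda>_. count_space A"])
  interpret M: prob_space M by fact
  interpret N: prob_space N by fact
  show "sets M = sets (\<Pi>\<^sub>M i\<in>UNIV. count_space A)" "sets N = sets (\<Pi>\<^sub>M i\<in>UNIV. count_space A)"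
    using M N by (simp_all add: full_shift_def)
  show "finite_measure M" by unfold_locales
  fix C :: "int \<Rightarrow> 'a set" and J :: "int set"
  assume J: "finite J"
  obtain a n where an: "\<And>s. s \<in> J \<Longrightarrow> a \<le> s \<and> s < a + int n"
  proof (cases "J = {}")
    case False
    show ?thesis
    proof (rule that[of "Min J" "nat (Max J - Min J + 1)"])
      fix s assume "s \<in> J"
      then show "Min J \<le> s \<and> s < Min J + int (nat (Max J - Min J + 1))"
        using Min_le[OF J] Max_ge[OF J] by fastforce
    qed
  qed (use that in auto)
  define P where "P v \<longleftrightarrow> (\<forall>s\<in>J. v ! nat (s - a) \<in> C s)" for v
  have emb: "prod_emb UNIV (\<lambda>_. count_space A) J (Pi\<^sub>E J C) = {x \<in> space L. P (window a n x)}"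
    if "sets L = sets (full_shift A)" for L
  proof -
    have "P (window a n x) \<longleftrightarrow> (\<forall>s\<in>J. x s \<in> C s)" for x
      using an by (simp add: P_def nth_window_diff)
    then show ?thesis
      using sets_eq_imp_space_eq[OF that]
      by (auto simp: prod_emb_def space_full_shift PiE_iff)
  qed
  show "emeasure M (prod_emb UNIV (\<lambda>_. count_space A) J (Pi\<^sub>E J C)) =
        emeasure N (prod_emb UNIV (\<lambda>_. count_space A) J (Pi\<^sub>E J C))"
    using measure_window_law[OF M(1), of P a n] measure_window_law[OF N(1), of P a n] eq
    by (simp add: M.emeasure_eq_measure N.emeasure_eq_measure emb[OF M(1)] flip: emb[OF N(1)])
qed

section \<open>Sites visited by a finite step word\<close>

text \<open>The sites are listed in the order of the visits, with repetitions, so that \<open>map x (sites u)\<close>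
  is what the walker reads in the scenery \<open>x\<close>.\<close>

definition sites :: "int list \<Rightarrow> int list" where
  "sites u = map (\<lambda>i. sum_list (take i u)) [0..<Suc (length u)]"

lemma length_sites [simp]: "length (sites u) = Suc (length u)"
  by (simp add: sites_def)

lemma sites_nth: "i \<le> length u \<Longrightarrow> sites u ! i = sum_list (take i u)"
  by (simp add: sites_def del: upt_Suc)

lemma sites_replicate: "sites (replicate N c) = map (\<lambda>i. int i * c) [0..<Suc N]"
  by (auto simp: sites_def sum_list_replicate min_def simp del: upt_Suc)

lemma map_sites_rights: "map x (sites (replicate N 1)) = window 0 (Suc N) x"
  by (simp add: sites_replicate window_def del: upt_Suc)

lemma map_sites_lefts: "map x (sites (replicate N (- 1))) = rev (window (- int N) (Suc N) x)"
  by (rule nth_equalityI)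
     (auto simp: sites_replicate rev_nth window_nth of_nat_diff simp del: upt_Suc)

lemma sum_list_steps:
  assumes "set v \<subseteq> {- 1, 0, 1 :: int}"
  shows "\<bar>sum_list v\<bar> \<le> int (length v)"
    and "sum_list v = int (length v) \<Longrightarrow> v = replicate (length v) 1"
    and "sum_list v = - int (length v) \<Longrightarrow> v = replicate (length v) (- 1)"
proof -
  have "\<bar>sum_list v\<bar> \<le> int (length v) \<and>
    (sum_list v = int (length v) \<longrightarrow> v = replicate (length v) 1) \<and>
    (sum_list v = - int (length v) \<longrightarrow> v = replicate (length v) (- 1))"
    using assms by (induction v) auto
  then show "\<bar>sum_list v\<bar> \<le> int (length v)"
    and "sum_list v = int (length v) \<Longrightarrow> v = replicate (length v) 1"
    and "sum_list v = - int (length v) \<Longrightarrow> v = replicate (length v) (- 1)"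
    by auto
qed

text \<open>With steps of size at most one, two visited sites can be at distance \<open>N = length u\<close> only if
  they are visited at times \<open>0\<close> and \<open>N\<close> and all steps between go the same way. If \<open>u\<close> is not
  straight, all visited sites are therefore less than \<open>N\<close> away from the leftmost one.\<close>

lemma sites_confined:
  assumes steps: "set u \<subseteq> {- 1, 0, 1}"
    and not_straight: "u \<noteq> replicate (length u) 1" "u \<noteq> replicate (length u) (- 1)"
  shows "\<exists>a. \<forall>s\<in>set (sites u). a \<le> s \<and> s < a + int (length u)"
proof -
  let ?p = "\<lambda>i. sum_list (take i u)" and ?N = "length u"
  have lip: "\<bar>?p j - ?p i\<bar> \<le> int j - int i" if "i \<le> j" "j \<le> ?N" for i j
  proof -
    have "take j u = take i u @ drop i (take j u)"
      using that by (metis append_take_drop_id min.absorb1 take_take)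
    then have "?p j - ?p i = sum_list (drop i (take j u))"
      by (metis add_diff_cancel_left' sum_list_append)
    moreover have "set (drop i (take j u)) \<subseteq> {- 1, 0, 1}"
      using steps by (meson order_trans set_drop_subset set_take_subset)
    ultimately show ?thesis
      using sum_list_steps(1)[of "drop i (take j u)"] that by simp
  qed
  have ends: "\<bar>?p ?N\<bar> < int ?N"
    using sum_list_steps[OF steps] not_straight by fastforce
  have diff: "?p j - ?p i < int ?N" if "i \<le> ?N" "j \<le> ?N" for i j
  proof (rule ccontr)
    assume far: "\<not> ?p j - ?p i < int ?N"
    \<comment> \<open>Only the two endpoints are far enough apart in time.\<close>
    then have "i = 0 \<and> j = ?N \<or> i = ?N \<and> j = 0"
      using lip[of i j] lip[of j i] that by (cases "i \<le> j") auto
    then show False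
      using far ends by auto
  qed
  have set_sites: "set (sites u) = ?p ` {..?N}"
    by (auto simp: sites_def simp del: upt_Suc)
  define m where "m = Min (set (sites u))"
  have "m \<in> set (sites u)"
    unfolding m_def by (rule Min_in) (auto simp: set_sites)
  then obtain i where "i \<le> ?N" "m = ?p i"
    by (auto simp: set_sites)
  moreover have "m \<le> s" if "s \<in> set (sites u)" for s
    using that by (simp add: m_def)
  ultimately show ?thesis
    using diff[of i] by (intro exI[of _ m]) (force simp: set_sites)
qed

section \<open>The law of the record\<close>

lemma recorded_eq_sites:
  assumes "i \<le> n"
  shows "recorded (int i) \<omega> x = x (sites (window 0 n \<omega>) ! i)"
proof -
  have "(\<Sum>k\<in>{0..<int i}. \<omega> k) = sum_list (map (\<lambda>k. \<omega> (int k)) [0..<i])"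
  proof (induction i)
    case (Suc i)
    have "{0..<int (Suc i)} = insert (int i) {0..<int i}" by auto
    then show ?case using Suc by simp
  qed simp
  then show ?thesis
    using assms by (simp add: recorded_def shift_pow_def sites_nth window_def take_map take_upt)
qed

lemma window_recording_map:
  "window 0 (Suc N) (recording_map (\<omega>, x)) = map x (sites (window 0 N \<omega>))"
  by (rule nth_equalityI)
     (auto simp: window_nth recording_map_def recorded_eq_sites)

lemma word_prob_eq_window:
  assumes "sets \<mu> = sets step_space"
  shows "word_prob \<mu> u = measure \<mu> {\<omega> \<in> space \<mu>. window 0 (length u) \<omega> = u}"
  using sets_eq_imp_space_eq[OF assms] by (simp add: word_prob_def window_eq_iff)

lemma measurable_map_sites:
  fixes A :: "'a :: countable set"
  assumes "sets M = sets (full_shift A)"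
  shows "{x \<in> space M. map x l = w} \<in> sets M"
proof -
  have comp: "(\<lambda>x. x k) \<in> measurable M (count_space UNIV)" for k
    unfolding measurable_cong_sets[OF assms refl]
    by (rule measurable_compose[OF measurable_component_full_shift]) simp
  then show ?thesis
    unfolding list_eq_iff_nth_eq by (simp cong: conj_cong) measurable
qed

text \<open>The record window depends on the walk only through its first \<open>N\<close> steps. Conditioning on
  them splits the event into disjoint rectangles, whose probabilities factor because the walk is
  independent of the scenery.\<close>

lemma record_window_law:
  assumes \<mu>: "sets \<mu> = sets step_space" "prob_space \<mu>"
    and \<nu>: "sets \<nu> = sets scenery_space" "prob_space \<nu>"
  shows "measure (window_law (record_measure \<mu> \<nu>) 0 (Suc N)) {w} =
    (\<Sum>u | set u \<subseteq> {- 1, 0, 1} \<and> length u = N.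
       word_prob \<mu> u * measure \<nu> {x \<in> space \<nu>. map x (sites u) = w})"
proof -
  interpret \<mu>: prob_space \<mu> by fact
  interpret \<nu>: prob_space \<nu> by fact
  interpret P: pair_prob_space \<mu> \<nu> ..
  let ?P = "\<mu> \<Otimes>\<^sub>M \<nu>" and ?U = "{u. set u \<subseteq> {- 1, 0, 1 :: int} \<and> length u = N}"
  let ?W = "\<lambda>u. {\<omega> \<in> space \<mu>. window 0 N \<omega> = u}"
  let ?S = "\<lambda>u. {x \<in> space \<nu>. map x (sites u) = w}"
  have W: "?W u \<in> sets \<mu>" for u
    using measurable_sets[OF measurable_window[of \<mu> "{- 1, 0, 1}" 0 N], of "{u}"] \<mu>(1)
    by (simp add: step_space_def vimage_def Int_def conj_commute)
  have S: "?S u \<in> sets \<nu>" for u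
    using \<nu>(1) by (intro measurable_map_sites[of \<nu> "{0, 1}"]) (simp add: scenery_space_def)
  have rec: "recording_map \<in> measurable ?P scenery_space"
    using measurable_recording_map
    by (subst measurable_cong_sets[OF sets_pair_measure_cong[OF \<mu>(1) \<nu>(1)] refl])
  have win: "window 0 (Suc N) \<in> measurable scenery_space (count_space UNIV)"
    by (rule measurable_window[where A = "{0, 1}"]) (simp add: scenery_space_def)
  have "window_law (record_measure \<mu> \<nu>) 0 (Suc N) =
      distr ?P (count_space UNIV) (\<lambda>z. window 0 (Suc N) (recording_map z))"
    unfolding window_law_def record_measure_def by (subst distr_distr[OF win rec]) (simp add: o_def)
  then have "measure (window_law (record_measure \<mu> \<nu>) 0 (Suc N)) {w} =
      measure ?P {z \<in> space ?P. window 0 (Suc N) (recording_map z) = w}"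
    using measurable_compose[OF rec win]
    by (simp add: measure_distr vimage_def Int_def conj_commute)
  also have "{z \<in> space ?P. window 0 (Suc N) (recording_map z) = w} = (\<Union>u\<in>?U. ?W u \<times> ?S u)"
  proof -
    have "window 0 N \<omega> \<in> ?U" if "\<omega> \<in> space \<mu>" for \<omega>
      using that sets_eq_imp_space_eq[OF \<mu>(1)]
      by (auto simp: window_def step_space_def space_full_shift)
    then show ?thesis
      by (auto simp: space_pair_measure window_recording_map)
  qed
  also have "measure ?P \<dots> = (\<Sum>u\<in>?U. measure ?P (?W u \<times> ?S u))"
  proof (rule P.finite_measure_finite_Union)
    show "finite ?U" by (rule finite_lists_length_eq) simp
    show "(\<lambda>u. ?W u \<times> ?S u) ` ?U \<subseteq> sets ?P" using W S by auto
    show "disjoint_family_on (\<lambda>u. ?W u \<times> ?S u) ?U" by (auto simp: disjoint_family_on_def)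
  qed
  also have "\<dots> = (\<Sum>u\<in>?U. word_prob \<mu> u * measure \<nu> (?S u))"
    by (rule sum.cong)
       (auto simp: measure_def \<nu>.emeasure_pair_measure_Times W S enn2real_mult
         word_prob_eq_window[OF \<mu>(1)])
  finally show ?thesis .
qed

section \<open>Recovering the scenery measure\<close>

lemma symmetric_system_trivial:
  fixes p q d e :: real
  assumes "p \<ge> 0" "q \<ge> 0" "p \<noteq> q" and "p * d + q * e = 0" "p * e + q * d = 0"
  shows "d = 0"
proof -
  have "(p - q) * (p + q) * d = p * (p * d + q * e) - q * (p * e + q * d)"
    by (simp add: algebra_simps)
  then have "(p - q) * (p + q) * d = 0"
    using assms by simp
  then show ?thesis
    using assms by auto
qed

text \<open>Induction step: the paths that are not straight give equal contributions for both sceneries,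
  since what they read is a function of a window of length \<open>N\<close>. What remains of the equality of the
  two records is the linear system for the straight paths.\<close>

lemma window_law_Suc_of_record:
  assumes \<mu>: "random_walk \<mu>" "strongly_asymmetric \<mu>"
    and \<nu>: "scenery_measure \<nu>" and \<nu>': "scenery_measure \<nu>'"
    and rec: "record_measure \<mu> \<nu> = record_measure \<mu> \<nu>'"
    and IH: "window_law \<nu> 0 N = window_law \<nu>' 0 N"
  shows "window_law \<nu> 0 (Suc N) = window_law \<nu>' 0 (Suc N)"
proof -
  have \<mu>_sets: "sets \<mu> = sets step_space" and \<mu>_prob: "prob_space \<mu>"
    using \<mu>(1) by (auto simp: random_walk_def ergodic_measure_def)
  have scen: "sets L = sets scenery_space" "sets L = sets (full_shift {0, 1})"
      "prob_space L" "distr L L shift = L" if "L \<in> {\<nu>, \<nu>'}" for L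
    using that \<nu> \<nu>' by (auto simp: scenery_measure_def ergodic_measure_def scenery_space_def)
  define read where "read L u w = measure L {x \<in> space L. map x (sites u) = w}"
    for L :: "(int \<Rightarrow> nat) measure" and u w
  let ?U = "{u. set u \<subseteq> {- 1, 0, 1 :: int} \<and> length u = N}"
  let ?r = "replicate N 1 :: int list" and ?l = "replicate N (- 1) :: int list"
  have U: "finite ?U" "?r \<in> ?U" "?l \<in> ?U"
    by (auto intro: finite_lists_length_eq)
  have right: "read L ?r w = measure (window_law L 0 (Suc N)) {w}" if "L \<in> {\<nu>, \<nu>'}" for L w
    using measure_window_law[OF scen(2)[OF that], of "\<lambda>v. v = w" 0 "Suc N"]
    by (simp add: read_def map_sites_rights)
  \<comment> \<open>The walk to the left reads the window that starts at \<open>- N\<close> from its right end.\<close>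
  have left: "read L ?l w = measure (window_law L 0 (Suc N)) {rev w}" if "L \<in> {\<nu>, \<nu>'}" for L w
    using measure_window_law[OF scen(2)[OF that], of "\<lambda>v. v = rev w" "- int N" "Suc N"]
    by (simp add: read_def map_sites_lefts rev_swap
        window_law_stationary[OF scen(2,4)[OF that], of "- int N"])
  have other: "read \<nu> u w = read \<nu>' u w" if u: "u \<in> ?U" "u \<noteq> ?r" "u \<noteq> ?l" for u w
  proof -
    obtain a where a: "\<And>s. s \<in> set (sites u) \<Longrightarrow> a \<le> s \<and> s < a + int N"
      using sites_confined[of u] u by auto
    have "read L u w = measure (window_law L 0 N) {v. map (\<lambda>s. v ! nat (s - a)) (sites u) = w}"
      if "L \<in> {\<nu>, \<nu>'}" for L
    proof -
      have in_window: "map (\<lambda>s. window a N x ! nat (s - a)) (sites u) = map x (sites u)"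
        for x :: "int \<Rightarrow> nat"
        using a by (simp add: nth_window_diff)
      show ?thesis
        using measure_window_law[OF scen(2)[OF that],
            of "\<lambda>v. map (\<lambda>s. v ! nat (s - a)) (sites u) = w" a N]
        by (simp only: read_def in_window window_law_stationary[OF scen(2,4)[OF that], of a])
    qed
    then show ?thesis
      using IH by simp
  qed
  have balance: "(\<Sum>u\<in>?U. word_prob \<mu> u * (read \<nu> u w - read \<nu>' u w)) = 0" for w
    using record_window_law[OF \<mu>_sets \<mu>_prob scen(1,3), of \<nu> N w]
      record_window_law[OF \<mu>_sets \<mu>_prob scen(1,3), of \<nu>' N w] rec
    by (simp add: read_def right_diff_distrib sum_subtractf)
  define d where
    "d w = measure (window_law \<nu> 0 (Suc N)) {w} - measure (window_law \<nu>' 0 (Suc N)) {w}" for w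
  have "d w = 0" for w
  proof (cases "N = 0")
    case True
    \<comment> \<open>Here the two straight words are both empty, and the sum has a single term.\<close>
    interpret \<mu>: prob_space \<mu> by fact
    have "word_prob \<mu> [] = 1"
      using \<mu>.prob_space sets_eq_imp_space_eq[OF \<mu>_sets] by (simp add: word_prob_def)
    moreover have "?U = {[]}" using True by auto
    ultimately show ?thesis
      using balance[of w] right[of \<nu> w] right[of \<nu>' w] True by (simp add: d_def)
  next
    case False
    let ?p = "word_prob \<mu> ?r" and ?q = "word_prob \<mu> ?l"
    have "?r \<noteq> ?l" using False by (cases N) auto
    have system: "?p * d w + ?q * d (rev w) = 0" for w
    proof -
      have "(\<Sum>u\<in>?U. word_prob \<mu> u * (read \<nu> u w - read \<nu>' u w)) =
          (\<Sum>u\<in>{?r, ?l}. word_prob \<mu> u * (read \<nu> u w - read \<nu>' u w))"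
        using U other by (intro sum.mono_neutral_right) auto
      then show ?thesis
        using balance[of w] \<open>?r \<noteq> ?l\<close> by (simp add: right left d_def)
    qed
    show ?thesis
    proof (rule symmetric_system_trivial)
      show "?p \<noteq> ?q" using \<mu>(2) False by (simp add: strongly_asymmetric_def)
      show "?p * d w + ?q * d (rev w) = 0" by (rule system)
      show "?p * d (rev w) + ?q * d w = 0" using system[of "rev w"] by simp
    qed (auto simp: word_prob_def)
  qed
  then show ?thesis
    by (intro window_law_eqI[where A = "{0, 1}"] scen) (auto simp: d_def)
qed

theorem theorem1:
  fixes \<mu> :: "(int \<Rightarrow> int) measure" and \<nu> \<nu>' :: "(int \<Rightarrow> nat) measure"
  assumes "random_walk \<mu>" and "strongly_asymmetric \<mu>"
    and "scenery_measure \<nu>" and "scenery_measure \<nu>'"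
    and "record_measure \<mu> \<nu> = record_measure \<mu> \<nu>'"
  shows "\<nu> = \<nu>'"
proof -
  have scen: "sets L = sets (full_shift {0, 1})" "prob_space L" "distr L L shift = L"
    if "L \<in> {\<nu>, \<nu>'}" for L
    using that assms(3,4) by (auto simp: scenery_measure_def ergodic_measure_def scenery_space_def)
  have "window_law \<nu> 0 n = window_law \<nu>' 0 n" for n
  proof (induction n)
    case 0
    \<comment> \<open>There is only one word of length 0, so both laws are the point mass at it.\<close>
    have "measure (window_law L 0 0) {[]} = 1" if "L \<in> {\<nu>, \<nu>'}" for L
      using measure_window_law[OF scen(1)[OF that], of "\<lambda>v. v = []" 0 0]
        prob_space.prob_space[OF scen(2)[OF that]] by (simp add: window_def)
    then show ?case
      by (intro window_law_eqI[where A = "{0, 1}"] scen) auto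
  next
    case (Suc n)
    then show ?case by (rule window_law_Suc_of_record[OF assms])
  qed
  then have "window_law \<nu> a n = window_law \<nu>' a n" for a n
    by (simp add: window_law_stationary[OF scen(1,3), of _ a])
  then show ?thesis
    by (intro measure_eqI_window_law[where A = "{0, 1}"] scen) auto
qed

end
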